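(* For every integer $n\ge 2$ and every $\varepsilon\in(0,1)$ there exists a convex body $B$ in $\mathbb{R}^n$ with $d_{BM}(B,B_\infty^n)\le 1+\varepsilon$ whose illumination number satisfies $\mathcal{I}(B)=2^n-1$.
   Context: A convex body in $\mathbb{R}^n$ is a compact convex set with non-empty interior; $\partial B$ is the boundary of $B$. $B_\infty^n=[-1,1]^n$. Illumination: a point $x\in\partial B$ is illuminated in direction $y\in\mathbb{R}^n\setminus\{0\}$ if there is an (arbitrarily small) $t>0$ such that $x+ty$ lies in the interior of $B$. A collection $\{y^1,\dots,y^m\}$ of non-zero vectors illuminates $B$ if every $x\in\partial B$ is illuminated in direction $y^i$ for some $i\le m$. The illumination number $\mathcal{I}(B)$ is the smallest cardinality of a set of directions illuminating $B$. Banach--Mazur distance: for (not necessarily centrally symmetric) convex bodies $B,L\subset\mathbb{R}^n$, $d_{BM}(B,L)$ is the infimum of all $\lambda\ge 1$ for which there are an invertible linear operator $T:\mathbb{R}^n\to\mathbb{R}^n$ and vectors $x,y\in\mathbb{R}^n$ with $B\subset T(L)+x\subset \lambda B+y$. *)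

theory Defs
  imports "HOL-Analysis.Analysis" "HOL-Library.Extended_Nat"
begin

definition convex_body :: "'a::euclidean_space set \<Rightarrow> bool" where
  "convex_body B \<longleftrightarrow> compact B \<and> convex B \<and> interior B \<noteq> {}"

definition unit_cube :: "(real ^ 'n) set" where
  "unit_cube = {x. \<forall>i. x $ i \<in> {-1..1}}"

definition illuminated_in_direction ::
    "'a::euclidean_space set \<Rightarrow> 'a \<Rightarrow> 'a \<Rightarrow> bool" where
  "illuminated_in_direction B x y \<longleftrightarrow> (\<exists>t>0. x + t *\<^sub>R y \<in> interior B)"

(* For convex bodies some t > 0 works iff arbitrarily small ones do. *)
lemma illuminated_in_direction_arbitrarily_small:
  assumes "convex_body B" "x \<in> frontier B"
  shows "illuminated_in_direction B x y \<longleftrightarrow>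
    (\<forall>\<delta>>0. \<exists>t. 0 < t \<and> t < \<delta> \<and> x + t *\<^sub>R y \<in> interior B)"
proof
  assume "illuminated_in_direction B x y"
  then obtain t where t: "t > 0" "x + t *\<^sub>R y \<in> interior B"
    by (auto simp: illuminated_in_direction_def)
  have B: "convex B" "x \<in> closure B"
    using assms by (auto simp: convex_body_def frontier_def)
  show "\<forall>\<delta>>0. \<exists>t. 0 < t \<and> t < \<delta> \<and> x + t *\<^sub>R y \<in> interior B"
  proof (intro allI impI)
    fix \<delta> :: real assume "\<delta> > 0"
    define e where "e = min 1 (\<delta> / (2 * t))"
    have e: "0 < e" "e \<le> 1"
      using t \<open>\<delta> > 0\<close> by (auto simp: e_def)
    have "e * t \<le> \<delta> / (2 * t) * t"
      using t by (intro mult_right_mono) (auto simp: e_def)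
    then have "e * t < \<delta>"
      using t \<open>\<delta> > 0\<close> by (simp add: field_simps)
    moreover have "x - e *\<^sub>R (x - (x + t *\<^sub>R y)) \<in> interior B"
      using mem_interior_closure_convex_shrink[OF B(1) t(2) B(2) e] .
    ultimately show "\<exists>t. 0 < t \<and> t < \<delta> \<and> x + t *\<^sub>R y \<in> interior B"
      using t e by (intro exI[of _ "e * t"]) (auto simp: algebra_simps)
  qed
next
  assume "\<forall>\<delta>>0. \<exists>t. 0 < t \<and> t < \<delta> \<and> x + t *\<^sub>R y \<in> interior B"
  then show "illuminated_in_direction B x y"
    unfolding illuminated_in_direction_def using zero_less_one by blast
qed

definition illuminates :: "'a::euclidean_space set \<Rightarrow> 'a set \<Rightarrow> bool" where
  "illuminates Y B \<longleftrightarrow>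
    0 \<notin> Y \<and> (\<forall>x\<in>frontier B. \<exists>y\<in>Y. illuminated_in_direction B x y)"

(* The infimum is a minimum, as enat is well-ordered; it would be infinite only if no
   finite set illuminated B, which cannot happen for a convex body. *)
definition illumination_number :: "'a::euclidean_space set \<Rightarrow> enat" where
  "illumination_number B = (INF Y\<in>{Y. finite Y \<and> illuminates Y B}. enat (card Y))"

(* Meant for convex bodies: for these the set of admissible factors is non-empty. *)
definition banach_mazur_dist ::
    "'a::euclidean_space set \<Rightarrow> 'a set \<Rightarrow> real" where
  "banach_mazur_dist B L = Inf {r. r \<ge> 1 \<and>
    (\<exists>T x y. linear T \<and> bij T \<and>
       B \<subseteq> (\<lambda>z. T z + x) ` L \<and>
       (\<lambda>z. T z + x) ` L \<subseteq> (\<lambda>z. r *\<^sub>R z + y) ` B)}"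

end

(* Cut off one vertex of the cube: B = {x in [-1,1]^n. x_1 + ... + x_n <= n - \<epsilon>}.
   The remaining 2^n - 1 vertices of the cube lie in B, and a direction illuminating one of them
   must have the opposite sign pattern, so 2^n - 1 directions are necessary. They are also
   sufficient: a point of the new facet has some coordinate x_i < 1, so the direction serving
   the vertex with -1 exactly there can serve it too, provided that its positive entries are so
   small that its coordinate sum is negative. *)
theory Submission
  imports Defs
begin

section \<open>The truncated cube and its interior\<close>

definition truncated_cube :: "real \<Rightarrow> (real ^ 'n) set" where
  "truncated_cube \<delta> = {x \<in> unit_cube. (\<Sum>i\<in>UNIV. x $ i) \<le> real CARD('n) - \<delta>}"

definition sign_vector :: "'n set \<Rightarrow> real ^ 'n" where
  "sign_vector S = (\<chi> i. if i \<in> S then 1 else -1)"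

text \<open>Meant for the vertex \<open>sign_vector S\<close>: each entry of
  \<open>lit_direction S\<close> has the opposite sign there. At most n - 1 entries 1/n sum to less
  than 1, so a single -1 outweighs them all.\<close>

definition lit_direction :: "'n set \<Rightarrow> real ^ 'n" where
  "lit_direction S = (\<chi> i. if i \<in> S then -1 else 1 / real CARD('n))"

lemma unit_cube_eq_cbox: "(unit_cube :: (real ^ 'n) set) = cbox (\<chi> i. -1) (\<chi> i. 1)"
  by (auto simp: unit_cube_def mem_box_cart)

lemma interior_unit_cube: "interior (unit_cube :: (real ^ 'n) set) = box (\<chi> i. -1) (\<chi> i. 1)"
  by (simp add: unit_cube_eq_cbox interior_cbox)

lemma truncated_cube_subset: "truncated_cube \<delta> \<subseteq> unit_cube"
  by (auto simp: truncated_cube_def)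

text \<open>The sum is an inner product with the all-ones vector, so truncation is intersection with
  a half-space; compactness and convexity follow at once.\<close>

lemma truncated_cube_eq_Int:
  "truncated_cube \<delta> = unit_cube \<inter> {x :: real ^ 'n. (\<chi> i. 1) \<bullet> x \<le> real CARD('n) - \<delta>}"
  by (auto simp: truncated_cube_def inner_vec_def)

lemma compact_truncated_cube: "compact (truncated_cube \<delta>)"
  unfolding truncated_cube_eq_Int unit_cube_eq_cbox
  by (intro compact_Int_closed compact_cbox closed_halfspace_le)

lemma convex_truncated_cube: "convex (truncated_cube \<delta>)"
  unfolding truncated_cube_eq_Int unit_cube_eq_cbox
  by (intro convex_Int convex_box convex_halfspace_le)

lemma in_interior_truncated_cube:
  fixes x :: "real ^ 'n"
  assumes "\<And>i. -1 < x $ i" "\<And>i. x $ i < 1" "(\<Sum>i\<in>UNIV. x $ i) < real CARD('n) - \<delta>"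
  shows "x \<in> interior (truncated_cube \<delta>)"
proof -
  let ?U = "box (\<chi> i. -1) (\<chi> i. 1) \<inter> {x :: real ^ 'n. (\<chi> i. 1) \<bullet> x < real CARD('n) - \<delta>}"
  have "open ?U"
    by (intro open_Int open_box open_halfspace_lt)
  moreover have "?U \<subseteq> truncated_cube \<delta>"
    unfolding truncated_cube_eq_Int unit_cube_eq_cbox using box_subset_cbox by fastforce
  moreover have "x \<in> ?U"
    using assms by (auto simp: mem_box_cart inner_vec_def)
  ultimately show ?thesis
    using interiorI by blast
qed

text \<open>These strict bounds determine the sign of every coordinate of a direction that
  illuminates a vertex.\<close>

lemma interior_truncated_cubeD:
  assumes "x \<in> interior (truncated_cube \<delta>)"
  shows "-1 < x $ i" "x $ i < 1"
proof -
  have "x \<in> box (\<chi> i. -1) (\<chi> i. 1)"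
    using assms interior_mono[OF truncated_cube_subset] interior_unit_cube by blast
  then show "-1 < x $ i" "x $ i < 1"
    by (auto simp: mem_box_cart)
qed

lemma convex_body_truncated_cube:
  assumes "\<delta> < real CARD('n)"
  shows "convex_body (truncated_cube \<delta> :: (real ^ 'n) set)"
proof -
  have "(0 :: real ^ 'n) \<in> interior (truncated_cube \<delta>)"
    by (rule in_interior_truncated_cube) (use assms in auto)
  then show ?thesis
    by (auto simp: convex_body_def compact_truncated_cube convex_truncated_cube)
qed

section \<open>Banach-Mazur distance to the cube\<close>

lemma unit_cube_subset_scaled_truncated_cube:
  assumes "1 \<le> r" "real CARD('n) \<le> r * (real CARD('n) - \<delta>)"
  shows "(unit_cube :: (real ^ 'n) set) \<subseteq> (\<lambda>z. r *\<^sub>R z) ` truncated_cube \<delta>"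
proof
  fix z :: "real ^ 'n" assume z: "z \<in> unit_cube"
  have le: "\<bar>z $ i\<bar> \<le> 1" for i
    using z by (auto simp: unit_cube_def abs_le_iff minus_le_iff)
  then have "\<bar>z $ i\<bar> \<le> r" for i
    using assms(1) order_trans by blast
  then have "(1 / r) *\<^sub>R z \<in> unit_cube"
    using assms(1) by (auto simp: unit_cube_def field_simps abs_le_iff minus_le_iff)
  moreover have "(\<Sum>i\<in>UNIV. z $ i) \<le> (\<Sum>i\<in>(UNIV :: 'n set). 1)"
    using le by (intro sum_mono) (simp add: abs_le_iff)
  \<comment> \<open>The sum is at most n, and the second assumption amounts to n / r \<le> n -
    \<delta>.\<close>
  then have "(\<Sum>i\<in>UNIV. z $ i) / r \<le> real CARD('n) - \<delta>"
    using assms by (simp add: field_simps)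
  then have "(\<Sum>i\<in>UNIV. ((1 / r) *\<^sub>R z) $ i) \<le> real CARD('n) - \<delta>"
    by (simp add: sum_divide_distrib)
  ultimately have "(1 / r) *\<^sub>R z \<in> truncated_cube \<delta>"
    by (simp add: truncated_cube_def)
  then show "z \<in> (\<lambda>z. r *\<^sub>R z) ` truncated_cube \<delta>"
    using assms(1) by (intro image_eqI[of _ _ "(1 / r) *\<^sub>R z"]) auto
qed

text \<open>The identity map with zero translations makes r an admissible factor; the lower bound 1
  on all factors ensures that the infimum lies below it.\<close>

lemma banach_mazur_dist_le:
  assumes "1 \<le> r" "B \<subseteq> L" "L \<subseteq> (\<lambda>z. r *\<^sub>R z) ` B"
  shows "banach_mazur_dist B L \<le> r"
  unfolding banach_mazur_dist_def
proof (rule cInf_lower)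
  show "bdd_below {r. r \<ge> 1 \<and> (\<exists>T x y. linear T \<and> bij T \<and>
      B \<subseteq> (\<lambda>z. T z + x) ` L \<and> (\<lambda>z. T z + x) ` L \<subseteq> (\<lambda>z. r *\<^sub>R z + y) ` B)}"
    by (rule bdd_belowI[of _ 1]) auto
  show "r \<in> {r. r \<ge> 1 \<and> (\<exists>T x y. linear T \<and> bij T \<and>
      B \<subseteq> (\<lambda>z. T z + x) ` L \<and> (\<lambda>z. T z + x) ` L \<subseteq> (\<lambda>z. r *\<^sub>R z + y) ` B)}"
    using assms linear_id
    by (auto intro!: exI[of _ "id :: 'a \<Rightarrow> 'a"] exI[of _ "0 :: 'a"])
qed

section \<open>Lower bound: the remaining vertices need distinct directions\<close>

lemma sign_vector_in_truncated_cube: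
  fixes S :: "'n::finite set"
  assumes "S \<noteq> UNIV" "\<delta> \<le> 2"
  shows "sign_vector S \<in> truncated_cube \<delta>"
proof -
  obtain k where k: "k \<notin> S" using assms(1) by blast
  \<comment> \<open>The entry -1 at k keeps the sum at most n - 2, whence the threshold 2 for
    \<delta>.\<close>
  have "(\<Sum>i\<in>UNIV. sign_vector S $ i) = -1 + (\<Sum>i\<in>UNIV - {k}. sign_vector S $ i)"
    using k by (subst sum.remove[of _ k]) (auto simp: sign_vector_def)
  also have "(\<Sum>i\<in>UNIV - {k}. sign_vector S $ i) \<le> (\<Sum>i\<in>UNIV - {k}. 1)"
    by (intro sum_mono) (simp add: sign_vector_def)
  also have "\<dots> = real CARD('n) - 1"
    by (simp add: card_Diff_singleton of_nat_diff Suc_leI)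
  finally show ?thesis
    using assms(2) by (auto simp: truncated_cube_def unit_cube_def sign_vector_def)
qed

text \<open>The set of negative coordinates of a direction recovers the vertex it illuminates, so
  this map sends Y onto all 2^n - 1 proper subsets of the index set.\<close>

lemma illuminates_truncated_cube_card_ge:
  fixes Y :: "(real ^ 'n) set"
  assumes "finite Y" "illuminates Y (truncated_cube \<delta>)" "\<delta> \<le> 2"
  shows "2 ^ CARD('n) - 1 \<le> card Y"
proof -
  have "S \<in> (\<lambda>y. {i. y $ i < 0}) ` Y" if "S \<noteq> UNIV" for S
  proof -
    let ?s = "sign_vector S :: real ^ 'n"
    \<comment> \<open>\<open>undefined\<close> is just some coordinate: one entry of absolute value
      1 already excludes the interior.\<close>
    have "?s $ undefined \<in> {-1, 1}"
      by (simp add: sign_vector_def)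
    then have "?s \<notin> interior (truncated_cube \<delta>)"
      using interior_truncated_cubeD[of ?s \<delta> undefined] by fastforce
    then have "?s \<in> frontier (truncated_cube \<delta>)"
      using sign_vector_in_truncated_cube[OF that assms(3)] closure_subset
      unfolding frontier_def by blast
    then obtain y t where y: "y \<in> Y" and t: "t > 0"
        and int: "?s + t *\<^sub>R y \<in> interior (truncated_cube \<delta>)"
      using assms(2) unfolding illuminates_def illuminated_in_direction_def by blast
    \<comment> \<open>An entry 1 must strictly fall and an entry -1 must strictly rise.\<close>
    have "i \<in> S \<longleftrightarrow> y $ i < 0" for i
      using interior_truncated_cubeD[OF int, of i] t
      by (auto simp: sign_vector_def mult_less_0_iff zero_less_mult_iff split: if_splits)
    then show ?thesis using y by blast
  qed
  then have "UNIV - {UNIV} \<subseteq> (\<lambda>y. {i. y $ i < 0}) ` Y"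
    by blast
  then have "card (UNIV - {UNIV :: 'n set}) \<le> card Y"
    using assms(1) surj_card_le by blast
  then show ?thesis
    by (simp add: card_Diff_singleton card_UNIV_set)
qed

section \<open>Upper bound: the chosen directions illuminate every boundary point\<close>

lemma sum_lit_direction_neg:
  fixes S :: "'n::finite set"
  assumes "S \<noteq> {}"
  shows "(\<Sum>i\<in>UNIV. lit_direction S $ i) < 0"
proof -
  obtain k where k: "k \<in> S" using assms by blast
  have "(\<Sum>i\<in>UNIV. lit_direction S $ i) = -1 + (\<Sum>i\<in>UNIV - {k}. lit_direction S $ i)"
    using k by (subst sum.remove[of _ k]) (auto simp: lit_direction_def)
  also have "(\<Sum>i\<in>UNIV - {k}. lit_direction S $ i) \<le> (\<Sum>i\<in>UNIV - {k}. 1 / real CARD('n))"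
    by (intro sum_mono) (simp add: lit_direction_def order_trans[of _ 0])
  also have "\<dots> = (real CARD('n) - 1) / real CARD('n)"
    by (simp add: card_Diff_singleton of_nat_diff Suc_leI)
  also have "\<dots> < 1"
    by simp
  finally show ?thesis by simp
qed

text \<open>A slack constraint survives small t by continuity; a tight one becomes strict because
  its slope is negative.\<close>

lemma eventually_affine_less:
  fixes a b c :: real
  assumes "a \<le> c" "a = c \<Longrightarrow> b < 0"
  shows "eventually (\<lambda>t. a + t * b < c) (at_right 0)"
proof (cases "a = c")
  case True
  then have "b < 0" using assms(2) by simp
  then show ?thesis
    using True by (auto simp: eventually_at_right_less mult_less_0_iff
        elim!: eventually_mono[OF eventually_at_right_less])
next
  case False
  have "((\<lambda>t. a + t * b) \<longlongrightarrow> a + 0 * b) (at_right 0)"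
    by (intro tendsto_intros)
  then show ?thesis
    using False assms(1) by (intro order_tendstoD) auto
qed

text \<open>Only the constraints tight at x restrict y. There are finitely many constraints, so one
  small t makes all of them strict.\<close>

lemma illuminated_in_direction_truncated_cubeI:
  fixes x y :: "real ^ 'n"
  assumes x: "x \<in> truncated_cube \<delta>"
    and up: "\<And>i. x $ i = 1 \<Longrightarrow> y $ i < 0" and down: "\<And>i. x $ i = -1 \<Longrightarrow> y $ i > 0"
    and sum: "(\<Sum>i\<in>UNIV. x $ i) = real CARD('n) - \<delta> \<Longrightarrow> (\<Sum>i\<in>UNIV. y $ i) < 0"
  shows "illuminated_in_direction (truncated_cube \<delta>) x y"
proof -
  have bd: "-1 \<le> x $ i" "x $ i \<le> 1" for i
    using x by (auto simp: truncated_cube_def unit_cube_def)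
  have "eventually (\<lambda>t. \<forall>i. x $ i + t * y $ i < 1) (at_right 0)"
    using bd up by (intro eventually_all_finite eventually_affine_less) auto
  \<comment> \<open>The lower bounds are negated to fit the form of
    \<open>eventually_affine_less\<close>.\<close>
  moreover have "eventually (\<lambda>t. \<forall>i. - x $ i + t * (- y $ i) < 1) (at_right 0)"
  proof (intro eventually_all_finite eventually_affine_less)
    fix i
    show "- x $ i \<le> 1" using bd(1)[of i] by simp
    show "- y $ i < 0" if "- x $ i = 1" using down[of i] that by simp
  qed
  moreover have "eventually (\<lambda>t. (\<Sum>i\<in>UNIV. x $ i) + t * (\<Sum>i\<in>UNIV. y $ i)
      < real CARD('n) - \<delta>) (at_right 0)"
    using x sum by (intro eventually_affine_less) (auto simp: truncated_cube_def)
  ultimately have "eventually (\<lambda>t. 0 < t \<and> x + t *\<^sub>R y \<in> interior (truncated_cube \<delta>)) (at_right 0)"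
    using eventually_at_right_less[of 0]
  proof eventually_elim
    case (elim t)
    have "-1 < x $ i + t * y $ i" for i
      using elim(2)[rule_format, of i] by simp
    then show ?case
      using elim by (auto intro!: in_interior_truncated_cube simp: sum.distrib sum_distrib_left)
  qed
  then obtain t where "0 < t" "x + t *\<^sub>R y \<in> interior (truncated_cube \<delta>)"
    using eventually_happens trivial_limit_at_right_real by blast
  then show ?thesis
    unfolding illuminated_in_direction_def by blast
qed

text \<open>The natural index for x is the set S of coordinates equal to 1. Its direction has the
  right signs, and a negative sum if S is nonempty; only points of the new facet with S empty need
  another choice.\<close>

lemma illuminates_lit_directions:
  assumes "0 < \<delta>" "\<delta> < 2" "CARD('n::finite) \<ge> 2"
  shows "illuminates (lit_direction ` (UNIV - {UNIV :: 'n set})) (truncated_cube \<delta>)"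
  unfolding illuminates_def
proof (intro conjI ballI)
  show "0 \<notin> lit_direction ` (UNIV - {UNIV :: 'n set})"
  proof
    assume "0 \<in> lit_direction ` (UNIV - {UNIV :: 'n set})"
    then obtain S :: "'n set" where "0 = lit_direction S"
      by blast
    from arg_cong[OF this, of "\<lambda>v. v $ undefined"] have "0 = lit_direction S $ undefined"
      by simp
    then show False
      by (simp add: lit_direction_def split: if_splits)
  qed
next
  fix x :: "real ^ 'n" assume "x \<in> frontier (truncated_cube \<delta>)"
  then have x: "x \<in> truncated_cube \<delta>"
    using compact_imp_closed[OF compact_truncated_cube] frontier_subset_closed by blast
  then have bd: "-1 \<le> x $ i" "x $ i \<le> 1" for i
    by (auto simp: truncated_cube_def unit_cube_def)
  have "\<exists>S. S \<noteq> UNIV \<and> illuminated_in_direction (truncated_cube \<delta>) x (lit_direction S)"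
  proof (cases "{i. x $ i = 1} = {} \<and> (\<Sum>i\<in>UNIV. x $ i) = real CARD('n) - \<delta>")
    case True
    let ?k = "undefined :: 'n"
    \<comment> \<open>On the new facet the other n - 1 coordinates sum to at most n - 1, so x_i
      \<ge> 1 - \<delta> > -1. No cube constraint is tight, and any direction with negative sum
      works.\<close>
    have gt: "-1 < x $ i" for i
    proof -
      have "(\<Sum>j\<in>UNIV. x $ j) = x $ i + (\<Sum>j\<in>UNIV - {i}. x $ j)"
        by (rule sum.remove) auto
      also have "(\<Sum>j\<in>UNIV - {i}. x $ j) \<le> (\<Sum>j\<in>UNIV - {i}. 1)"
        using bd by (intro sum_mono) auto
      also have "\<dots> = real CARD('n) - 1"
        by (simp add: card_Diff_singleton of_nat_diff Suc_leI)
      finally show ?thesis using True assms(2) by simp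
    qed
    have "illuminated_in_direction (truncated_cube \<delta>) x (lit_direction {?k})"
      using x
    proof (rule illuminated_in_direction_truncated_cubeI)
      show "lit_direction {?k} $ i < 0" if "x $ i = 1" for i
        using True that by blast
      show "lit_direction {?k} $ i > 0" if "x $ i = -1" for i
        using gt[of i] that by simp
      show "(\<Sum>i\<in>UNIV. lit_direction {?k} $ i) < 0"
        by (rule sum_lit_direction_neg) simp
    qed
    \<comment> \<open>A singleton is an allowed index because n \<ge> 2.\<close>
    moreover have "{?k} \<noteq> UNIV"
    proof
      assume "{?k} = UNIV"
      from arg_cong[OF this, of card] have "CARD('n) = 1" by simp
      then show False using assms(3) by simp
    qed
    ultimately show ?thesis by (intro exI[of _ "{?k}"] conjI)
  next
    case False
    let ?S = "{i. x $ i = 1}"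
    \<comment> \<open>Otherwise x would be the vertex that was cut off.\<close>
    have "?S \<noteq> UNIV"
    proof
      assume "?S = UNIV"
      then have "(\<Sum>i\<in>UNIV. x $ i) = (\<Sum>i\<in>(UNIV :: 'n set). 1)"
        by (intro sum.cong) auto
      then show False
        using x assms(1) by (simp add: truncated_cube_def)
    qed
    moreover have "illuminated_in_direction (truncated_cube \<delta>) x (lit_direction ?S)"
      using x
    proof (rule illuminated_in_direction_truncated_cubeI)
      show "(\<Sum>i\<in>UNIV. lit_direction ?S $ i) < 0" if "(\<Sum>i\<in>UNIV. x $ i) = real CARD('n) - \<delta>"
        by (rule sum_lit_direction_neg) (use that False in simp)
      show "lit_direction ?S $ i < 0" if "x $ i = 1" for i
        using that by (simp add: lit_direction_def)
      show "lit_direction ?S $ i > 0" if "x $ i = -1" for i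
        using that by (simp add: lit_direction_def)
    qed
    ultimately show ?thesis by (intro exI[of _ ?S] conjI)
  qed
  then show "\<exists>y\<in>lit_direction ` (UNIV - {UNIV}). illuminated_in_direction (truncated_cube \<delta>) x y"
    by blast
qed

section \<open>The illumination number and the final choice of the cut\<close>

lemma illumination_number_truncated_cube:
  assumes "0 < \<delta>" "\<delta> < 2" "CARD('n::finite) \<ge> 2"
  shows "illumination_number (truncated_cube \<delta> :: (real ^ 'n) set) = enat (2 ^ CARD('n) - 1)"
proof (rule antisym)
  let ?Y = "lit_direction ` (UNIV - {UNIV :: 'n set})"
  have "card ?Y \<le> card (UNIV - {UNIV :: 'n set})"
    by (rule card_image_le) simp
  also have "\<dots> = 2 ^ CARD('n) - 1"
    by (simp add: card_Diff_singleton card_UNIV_set)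
  finally show "illumination_number (truncated_cube \<delta> :: (real ^ 'n) set) \<le> enat (2 ^ CARD('n) - 1)"
    unfolding illumination_number_def
    using illuminates_lit_directions[OF assms] by (intro INF_lower2[of ?Y]) auto
  have "2 ^ CARD('n) - 1 \<le> card Y"
    if "finite Y" "illuminates Y (truncated_cube \<delta>)" for Y :: "(real ^ 'n) set"
    using that less_imp_le[OF assms(2)] by (rule illuminates_truncated_cube_card_ge)
  then show "enat (2 ^ CARD('n) - 1) \<le> illumination_number (truncated_cube \<delta> :: (real ^ 'n) set)"
    unfolding illumination_number_def by (intro INF_greatest) auto
qed

theorem mainTheorem2:
  fixes \<epsilon> :: real
  assumes "CARD('n::finite) \<ge> 2" and "0 < \<epsilon>" and "\<epsilon> < 1"
  shows "\<exists>B :: (real ^ 'n) set. convex_body B \<and>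
           banach_mazur_dist B unit_cube \<le> 1 + \<epsilon> \<and>
           illumination_number B = enat (2 ^ CARD('n) - 1)"
proof (intro exI conjI)
  have n: "real CARD('n) \<ge> 2"
    using assms(1) by simp
  show "convex_body (truncated_cube \<epsilon> :: (real ^ 'n) set)"
    using n assms by (intro convex_body_truncated_cube) simp
  \<comment> \<open>This product is (1 + \<epsilon>)(n - \<epsilon>) - n, so cutting at depth
    \<delta> = \<epsilon> permits the factor 1 + \<epsilon>.\<close>
  have "0 \<le> \<epsilon> * (real CARD('n) - 1 - \<epsilon>)"
    using n assms by (intro mult_nonneg_nonneg) auto
  then have "real CARD('n) \<le> (1 + \<epsilon>) * (real CARD('n) - \<epsilon>)"
    by (simp add: algebra_simps)
  then show "banach_mazur_dist (truncated_cube \<epsilon> :: (real ^ 'n) set) unit_cube \<le> 1 + \<epsilon>"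
    using assms by (intro banach_mazur_dist_le truncated_cube_subset
        unit_cube_subset_scaled_truncated_cube) auto
  show "illumination_number (truncated_cube \<epsilon> :: (real ^ 'n) set) = enat (2 ^ CARD('n) - 1)"
    using assms by (intro illumination_number_truncated_cube) auto
qed

end
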